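(* Let $\mathcal{C}\subseteq\mathcal{G}_q(N,k)$ be a constant-dimension code. If $M_1$ correctly reconstructs the transmitted codeword $S\in\mathcal{C}$ from a received subspace $U\subseteq\mathbb{F}_q^N$, then $M_2$ also reconstructs it correctly from $U$.
   Context: $\mathcal{G}_q(N,k)$ is the set of $k$-dimensional subspaces of $\mathbb{F}_q^N$; a constant-dimension code is a nonempty subset of it. An atom is a one-dimensional subspace. For a subspace $S$, a set of atoms $\{A_1,\dots,A_r\}$ is an atomic decomposition of $S$ if $A_1+\cdots+A_r=S$. It is minimal if no proper subset of it is an atomic decomposition of $S$. $\mathfrak{N}(S)$ denotes the number of minimal atomic decompositions of $S$. $M_1$ denotes a minimum-distance decoder for $\mathcal{C}$ with respect to the classical subspace distance $d(S,T)=\dim S+\dim T-2\dim(S\cap T)$. $M_2$ denotes a minimum-distance decoder for $\mathcal{C}$ with respect to the $\mathfrak{N}$-induced distance $d_{\mathfrak{N}}(S,T)=\mathfrak{N}(S)+\mathfrak{N}(T)-2\,\mathfrak{N}(S\cap T)$. A minimum-distance decoder outputs a codeword at minimal distance from the received subspace $U$. A decoder correctly reconstructs the transmitted codeword $S$ from $U$ when $S$ is the unique codeword of $\mathcal{C}$ at minimal distance (in the corresponding distance) from $U$. *)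

theory Defs
  imports "HOL-Analysis.Cartesian_Space" "HOL-Library.Set_Algebras"
begin

text \<open>
  The ambient space \<open>F_q^N\<close> is \<open>'a ^ 'n\<close> with \<open>'a :: {field, finite}\<close>, so that
  \<open>q = CARD('a)\<close> and \<open>N = CARD('n)\<close>. Subspaces and dimensions are those of the vector space
  with scalar multiplication \<open>(*s)\<close>.
\<close>

definition grassmannian :: "nat \<Rightarrow> ('a :: field ^ 'n) set set" where
  "grassmannian k = {S. vec.subspace S \<and> vec.dim S = k}"

definition constant_dimension_code :: "nat \<Rightarrow> ('a :: field ^ 'n) set set \<Rightarrow> bool" where
  "constant_dimension_code k C \<longleftrightarrow> C \<noteq> {} \<and> C \<subseteq> grassmannian k"

definition atom :: "('a :: field ^ 'n) set \<Rightarrow> bool" where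
  "atom A \<longleftrightarrow> vec.subspace A \<and> vec.dim A = 1"

text \<open>
  \<open>\<Sum>D\<close> is the elementwise sum \<open>A\<^sub>1 + \<dots> + A\<^sub>r\<close> of the subspaces in \<open>D = {A\<^sub>1, \<dots>, A\<^sub>r}\<close>.
  A decomposition has at least one atom (\<open>r \<ge> 1\<close>), so the zero subspace has none. Admitting the
  empty decomposition would give the zero subspace and every atom the same number of minimal
  decompositions, and the distance induced by that number would not separate them.
\<close>

definition atomic_decomposition :: "('a :: field ^ 'n) set set \<Rightarrow> ('a ^ 'n) set \<Rightarrow> bool" where
  "atomic_decomposition D S \<longleftrightarrow>
     finite D \<and> D \<noteq> {} \<and> (\<forall>A\<in>D. atom A) \<and> \<Sum>D = S"

definition minimal_atomic_decomposition ::
    "('a :: field ^ 'n) set set \<Rightarrow> ('a ^ 'n) set \<Rightarrow> bool" where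
  "minimal_atomic_decomposition D S \<longleftrightarrow>
     atomic_decomposition D S \<and> (\<forall>D'. D' \<subset> D \<longrightarrow> \<not> atomic_decomposition D' S)"

definition num_min_decomp :: "('a :: {field, finite} ^ 'n) set \<Rightarrow> nat" where
  "num_min_decomp S = card {D. minimal_atomic_decomposition D S}"

definition subspace_dist :: "('a :: field ^ 'n) set \<Rightarrow> ('a ^ 'n) set \<Rightarrow> int" where
  "subspace_dist S T = int (vec.dim S) + int (vec.dim T) - 2 * int (vec.dim (S \<inter> T))"

definition decomp_dist :: "('a :: {field, finite} ^ 'n) set \<Rightarrow> ('a ^ 'n) set \<Rightarrow> int" where
  "decomp_dist S T =
     int (num_min_decomp S) + int (num_min_decomp T) - 2 * int (num_min_decomp (S \<inter> T))"

definition nearest_codewords ::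
    "('v set \<Rightarrow> 'v set \<Rightarrow> int) \<Rightarrow> 'v set set \<Rightarrow> 'v set \<Rightarrow> 'v set set" where
  "nearest_codewords d C U = {S \<in> C. \<forall>T\<in>C. d S U \<le> d T U}"

definition minimum_distance_decoder ::
    "(('a :: field ^ 'n) set \<Rightarrow> ('a ^ 'n) set \<Rightarrow> int) \<Rightarrow> ('a ^ 'n) set set \<Rightarrow>
     (('a ^ 'n) set \<Rightarrow> ('a ^ 'n) set) \<Rightarrow> bool" where
  "minimum_distance_decoder d C M \<longleftrightarrow>
     (\<forall>U. vec.subspace U \<longrightarrow> M U \<in> nearest_codewords d C U)"

text \<open>
  Correct reconstruction requires \<open>S\<close> to be the only nearest codeword; an output \<open>S\<close> that is
  due to tie-breaking does not count.
\<close>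

definition correctly_reconstructs ::
    "('v set \<Rightarrow> 'v set \<Rightarrow> int) \<Rightarrow> 'v set set \<Rightarrow> ('v set \<Rightarrow> 'v set) \<Rightarrow> 'v set \<Rightarrow> 'v set \<Rightarrow> bool" where
  "correctly_reconstructs d C M S U \<longleftrightarrow> nearest_codewords d C U = {S} \<and> M U = S"

lemma correctly_reconstructs_iff:
  assumes "minimum_distance_decoder d C M" and "vec.subspace U"
  shows "correctly_reconstructs d C M S U \<longleftrightarrow> nearest_codewords d C U = {S}"
  using assms by (auto simp: minimum_distance_decoder_def correctly_reconstructs_def)

end

theory Submission
  imports Defs
begin

text \<open>
  All codewords have the same dimension \<open>k\<close>. For a distance of the form
  \<open>g S + g U - 2 * g (S \<inter> U)\<close> in which \<open>g\<close> is a strictly increasing function of the dimension,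
  the nearest codewords are therefore those that meet \<open>U\<close> in the largest dimension, whatever \<open>g\<close>
  is. The subspace distance has \<open>g = dim\<close>, so it remains to see that the number of minimal atomic
  decompositions is also a strictly increasing function of the dimension.

  A minimal atomic decomposition of \<open>S\<close> is a nonempty basis
  of \<open>S\<close> considered up to rescaling of its vectors (\<open>minimal_atomic_decomposition_iff_basis\<close>).
  Linear isomorphisms carry bases to bases, so the number depends on the dimension alone
  (\<open>num_min_decomp_eq_if_dim_eq\<close>). If \<open>A\<close> is properly contained in \<open>B\<close>, then adjoining a fixed set
  \<open>E\<close> of vectors turns every nonempty basis of \<open>A\<close> into a basis of \<open>B\<close>, and the basis of \<open>A\<close> can be
  recovered from the result. Since \<open>B\<close> also has a basis that is not obtained in this way, its number
  is larger (\<open>num_min_decomp_psubset\<close>).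
\<close>

section \<open>Minimal decompositions as bases up to scaling\<close>

abbreviation line :: "'a :: field ^ 'n \<Rightarrow> ('a ^ 'n) set" where
  "line v \<equiv> vec.span {v}"

lemma sum_subspaces_eq_span:
  fixes D :: "('a :: field ^ 'n) set set"
  assumes "finite D" and "\<forall>A\<in>D. vec.subspace A"
  shows "\<Sum>D = vec.span (\<Union>D)"
  using assms
proof (induction D rule: finite_induct)
  case empty
  then show ?case by simp
next
  case (insert A D)
  then have "vec.span (A \<union> \<Union>D) = A + vec.span (\<Union>D)"
    by (auto simp: vec.span_Un set_plus_def vec.span_eq_iff[THEN iffD2])
  with insert show ?case by simp
qed

lemma sum_lines_eq_span:
  fixes V :: "('a :: field ^ 'n) set"
  assumes "finite V"
  shows "\<Sum>(line ` V) = vec.span V"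
proof -
  have "\<Sum>(line ` V) = vec.span (\<Union>v\<in>V. line v)"
    using assms by (subst sum_subspaces_eq_span) auto
  also have "\<dots> = vec.span V"
  proof (rule vec.span_eq[THEN iffD2, OF conjI])
    show "(\<Union>v\<in>V. line v) \<subseteq> vec.span V"
      using vec.span_mono[of "{v}" V for v] by blast
    show "V \<subseteq> vec.span (\<Union>v\<in>V. line v)"
      by (force intro: vec.span_base)
  qed
  finally show ?thesis .
qed

lemma atom_line:
  fixes v :: "'a :: field ^ 'n"
  assumes "v \<noteq> 0"
  shows "atom (line v)"
  using assms vec.dim_span_eq_card_independent[of "{v}"] by (simp add: atom_def)

lemma atom_imp_line:
  fixes A :: "('a :: field ^ 'n) set"
  assumes "atom A"
  obtains v where "v \<noteq> 0" and "A = line v"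
proof -
  obtain B where B: "B \<subseteq> A" "vec.independent B" "A \<subseteq> vec.span B" "card B = vec.dim A"
    using vec.basis_exists by blast
  with assms obtain v where v: "B = {v}"
    by (metis atom_def card_1_singletonE)
  have "A = line v"
    using B assms v vec.span_minimal[of B A] by (auto simp: atom_def)
  moreover have "v \<noteq> 0" using B v by simp
  ultimately show thesis using that by blast
qed

text \<open>
  From the generators of the atoms of a decomposition a basis can be selected, so a minimal
  decomposition contains no other atoms. Conversely, a proper subset of a basis does not span.
  The condition \<open>V \<noteq> {}\<close> reflects that a decomposition is nonempty; it excludes the zero subspace.
\<close>

lemma minimal_atomic_decomposition_iff_basis:
  fixes S :: "('a :: field ^ 'n) set"
  shows "minimal_atomic_decomposition D S \<longleftrightarrow>
    (\<exists>V. vec.independent V \<and> V \<noteq> {} \<and> vec.span V = S \<and> D = line ` V)"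
proof
  assume min: "minimal_atomic_decomposition D S"
  then have D: "finite D" "D \<noteq> {}" "\<And>A. A \<in> D \<Longrightarrow> atom A" "\<Sum>D = S"
    by (auto simp: minimal_atomic_decomposition_def atomic_decomposition_def)
  define g where "g A = (SOME v. v \<noteq> 0 \<and> A = line v)" for A :: "('a ^ 'n) set"
  have g: "g A \<noteq> 0 \<and> line (g A) = A" if "A \<in> D" for A
  proof -
    have "\<exists>v. v \<noteq> 0 \<and> A = line v" using atom_imp_line[OF D(3)[OF that]] by blast
    from someI_ex[OF this] show ?thesis unfolding g_def by simp
  qed
  have "line ` g ` D = D"
    unfolding image_image using g by simp
  then have span: "vec.span (g ` D) = S"
    using sum_lines_eq_span[of "g ` D"] D by simp
  obtain V where V: "V \<subseteq> g ` D" "vec.independent V" "g ` D \<subseteq> vec.span V"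
    using vec.maximal_independent_subset by blast
  have spanV: "vec.span V = S"
    using V(1,3) span vec.span_mono[OF V(1)] vec.span_minimal[OF V(3)] by auto
  have "V \<noteq> {}"
    using V(3) D(2) g by auto
  have finV: "finite V" using V(2) by (rule vec.finiteI_independent)
  have sub: "line ` V \<subseteq> D"
    using V(1) g by auto
  have "atomic_decomposition (line ` V) S"
    using sum_lines_eq_span[OF finV] finV spanV \<open>V \<noteq> {}\<close> sub D(3)
    by (auto simp: atomic_decomposition_def)
  with sub have "D = line ` V"
    using min by (auto simp: minimal_atomic_decomposition_def)
  with V(2) \<open>V \<noteq> {}\<close> spanV
  show "\<exists>V. vec.independent V \<and> V \<noteq> {} \<and> vec.span V = S \<and> D = line ` V" by blast
next
  assume "\<exists>V. vec.independent V \<and> V \<noteq> {} \<and> vec.span V = S \<and> D = line ` V"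
  then obtain V where V: "vec.independent V" "V \<noteq> {}" "vec.span V = S" "D = line ` V" by blast
  have finV: "finite V" using V(1) by (rule vec.finiteI_independent)
  have "v \<noteq> 0" if "v \<in> V" for v
    using V(1) that vec.dependent_zero by blast
  then have dec: "atomic_decomposition D S"
    using V finV sum_lines_eq_span[OF finV] by (auto simp: atomic_decomposition_def atom_line)
  have "\<not> atomic_decomposition D' S" if "D' \<subset> D" for D'
  proof
    assume "atomic_decomposition D' S"
    then have "\<Sum>D' = S" by (simp add: atomic_decomposition_def)
    moreover obtain V' where V': "V' \<subseteq> V" "D' = line ` V'"
      using \<open>D' \<subset> D\<close> V(4) by (meson psubset_imp_subset subset_imageE)
    ultimately have "vec.span V' = vec.span V"
      using sum_lines_eq_span[of V'] finite_subset[OF V'(1) finV] V(3) by simp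
    moreover have "V' \<noteq> V" using \<open>D' \<subset> D\<close> V(4) V'(2) by blast
    then obtain v where "v \<in> V" "v \<notin> V'" using V'(1) by blast
    ultimately have "v \<in> vec.span (V - {v})"
      using vec.span_mono[of V' "V - {v}"] V'(1) vec.span_base[of v V] by blast
    with V(1) \<open>v \<in> V\<close> show False
      by (auto simp: vec.dependent_def)
  qed
  with dec show "minimal_atomic_decomposition D S"
    by (simp add: minimal_atomic_decomposition_def)
qed

lemma minimal_atomic_decomposition_subset:
  fixes S :: "('a :: field ^ 'n) set"
  assumes "minimal_atomic_decomposition D S" and "X \<in> D"
  shows "X \<subseteq> S"
proof -
  obtain V where "vec.span V = S" "D = line ` V"
    using assms(1) by (auto simp: minimal_atomic_decomposition_iff_basis)
  with assms(2) show ?thesis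
    using vec.span_mono[of "{v}" V for v] by blast
qed

section \<open>The number of minimal decompositions as a function of the dimension\<close>

lemma num_min_decomp_le_if_dim_eq:
  fixes A B :: "('a :: {field, finite} ^ 'n) set"
  assumes "vec.subspace A" and "vec.subspace B" and "vec.dim A = vec.dim B"
  shows "num_min_decomp A \<le> num_min_decomp B"
proof -
  obtain f where f: "Vector_Spaces.linear (*s) (*s) f" "f ` A = B" "inj_on f A"
    using vec.subspace_isomorphism[OF assms] by blast
  have line: "f ` line v = line (f v)" for v
    using vec.linear_span_image[OF f(1), of "{v}"] by simp
  have "image f ` D \<in> {D. minimal_atomic_decomposition D B}"
    if D: "minimal_atomic_decomposition D A" for D
  proof -
    obtain V where V: "vec.independent V" "V \<noteq> {}" "vec.span V = A" "D = line ` V"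
      using D by (auto simp: minimal_atomic_decomposition_iff_basis)
    have "vec.independent (f ` V)"
      using vec.linear_independent_injective_image[OF f(1) V(1)] f(3) V(3) by simp
    moreover have "vec.span (f ` V) = B"
      using vec.linear_span_image[OF f(1), of V] f(2) V(3) by simp
    moreover have "image f ` D = line ` f ` V"
      using V(4) by (simp add: image_image line)
    ultimately show ?thesis
      using V(2) by (auto simp: minimal_atomic_decomposition_iff_basis)
  qed
  moreover have "inj_on (image (image f)) {D. minimal_atomic_decomposition D A}"
  proof (rule inj_on_subset)
    show "inj_on (image (image f)) (Pow (Pow A))"
      using f(3) by (intro inj_on_image_Pow)
    show "{D. minimal_atomic_decomposition D A} \<subseteq> Pow (Pow A)"
      using minimal_atomic_decomposition_subset by blast
  qed
  ultimately show ?thesis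
    unfolding num_min_decomp_def by (intro card_inj_on_le) auto
qed

lemma num_min_decomp_eq_if_dim_eq:
  fixes A B :: "('a :: {field, finite} ^ 'n) set"
  assumes "vec.subspace A" and "vec.subspace B" and "vec.dim A = vec.dim B"
  shows "num_min_decomp A = num_min_decomp B"
  using assms num_min_decomp_le_if_dim_eq[of A B] num_min_decomp_le_if_dim_eq[of B A] by simp

text \<open>
  Let \<open>V\<^sub>0 \<union> E\<close> be a basis of \<open>B\<close> that extends a basis \<open>V\<^sub>0\<close> of \<open>A\<close>. Every basis of \<open>A\<close> can take the
  place of \<open>V\<^sub>0\<close>, and the atoms in \<open>A\<close> are then told apart from the lines of \<open>E\<close> by lying in \<open>A\<close>. This
  embeds the decompositions of \<open>A\<close> into those of \<open>B\<close>. A decomposition outside the image arises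
  when some \<open>e \<in> E\<close> is replaced by \<open>a + e\<close> with \<open>a \<in> V\<^sub>0\<close>, because the line of \<open>e\<close> is then lost. If
  \<open>A\<close> is the zero subspace there is no such \<open>a\<close>, but then \<open>A\<close> has no decomposition at all.
\<close>

lemma num_min_decomp_psubset:
  fixes A B :: "('a :: {field, finite} ^ 'n) set"
  assumes "vec.subspace A" and "vec.subspace B" and "A \<subset> B"
  shows "num_min_decomp A < num_min_decomp B"
proof -
  obtain V0 where V0: "V0 \<subseteq> A" "vec.independent V0" "A \<subseteq> vec.span V0"
    using vec.maximal_independent_subset by blast
  have spanV0: "vec.span V0 = A"
    using V0 assms(1) vec.span_minimal by blast
  obtain W where W: "V0 \<subseteq> W" "W \<subseteq> B" "vec.independent W" "B \<subseteq> vec.span W"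
    using vec.maximal_independent_subset_extend[of V0 B] V0 assms(3) by blast
  have spanW: "vec.span W = B"
    using W assms(2) vec.span_minimal by blast
  have finW: "finite W" using W(3) by (rule vec.finiteI_independent)
  define E where "E = W - V0"
  have WE: "W = V0 \<union> E" using W(1) by (auto simp: E_def)
  obtain e where e: "e \<in> E"
    using WE spanV0 spanW assms(3) by fastforce
  have e_notin: "x \<notin> A" if "x \<in> E" for x
  proof
    assume "x \<in> A"
    then have "x \<in> vec.span (W - {x})"
      using spanV0 that vec.span_mono[of V0 "W - {x}"] W(1) by (auto simp: E_def)
    with that W(3) show False by (auto simp: E_def vec.dependent_def)
  qed
  let ?MA = "{D. minimal_atomic_decomposition D A}"
  let ?MB = "{D. minimal_atomic_decomposition D B}"
  let ?h = "\<lambda>D. D \<union> line ` E"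
  have h_in: "?h D \<in> ?MB" if D: "D \<in> ?MA" for D
  proof -
    obtain V where V: "vec.independent V" "vec.span V = A" "D = line ` V"
      using D by (auto simp: minimal_atomic_decomposition_iff_basis)
    have finV: "finite V" using V(1) by (rule vec.finiteI_independent)
    have span: "vec.span (V \<union> E) = B"
      unfolding spanW[symmetric] WE by (simp add: vec.span_Un V(2) spanV0)
    have "card V = card V0"
      using vec.dim_span_eq_card_independent[OF V(1)] vec.dim_span_eq_card_independent[OF V0(2)]
        V(2) spanV0 by simp
    \<comment> \<open>A spanning set with at most \<open>dim B\<close> elements is a basis.\<close>
    then have "card (V \<union> E) \<le> card W"
      using card_Un_le[of V E] finW W(1) by (simp add: E_def card_Diff_subset finite_subset card_mono)
    also have "\<dots> = vec.dim B"
      using vec.dim_span_eq_card_independent[OF W(3)] spanW by simp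
    finally have "vec.independent (V \<union> E)"
      using vec.card_le_dim_spanning[of "V \<union> E" B] span finV finW vec.span_superset[of "V \<union> E"]
      by (simp add: E_def)
    then show ?thesis
      using span e V(3) by (auto simp: minimal_atomic_decomposition_iff_basis image_Un)
  qed
  have "\<not> X \<subseteq> A" if "X \<in> line ` E" for X
    using that e_notin vec.span_base by blast
  then have "{X \<in> ?h D. X \<subseteq> A} = D" if "D \<in> ?MA" for D
    using that minimal_atomic_decomposition_subset by blast
  then have inj: "inj_on ?h ?MA"
    by (rule inj_on_inverseI)
  have "?h ` ?MA \<noteq> ?MB"
  proof (cases "V0 = {}")
    case True
    have "?MA = {}"
    proof -
      have "A = {0}" using spanV0 True by simp
      then have "V = {}" if "vec.independent V" "vec.span V = A" for V
        using that vec.span_superset[of V] vec.dependent_zero[of V] subset_singleton_iff by auto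
      then show ?thesis by (auto simp: minimal_atomic_decomposition_iff_basis)
    qed
    moreover have "line ` W \<in> ?MB"
      using W(3) spanW e by (auto simp: minimal_atomic_decomposition_iff_basis WE)
    ultimately show ?thesis by blast
  next
    case False
    then obtain a where a: "a \<in> V0" by blast
    then have aW: "a \<in> W - {e}" using e W(1) by (auto simp: E_def)
    define W' where "W' = insert (a + e) (W - {e})"
    have "e \<in> W" using e by (simp add: E_def)
    have e_span: "e \<notin> vec.span (W - {e})"
      using W(3) \<open>e \<in> W\<close> by (auto simp: vec.dependent_def)
    have ae: "a + e \<notin> vec.span (W - {e})"
      using e_span aW vec.span_diff[of "a + e" "W - {e}" a] vec.span_base[of a "W - {e}"] by auto
    have "vec.independent (W - {e})" using W(3) vec.independent_mono by blast
    then have indep: "vec.independent W'"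
      unfolding W'_def using ae by (simp add: vec.independent_insert)
    have span: "vec.span W' = B"
    proof -
      have "e \<in> vec.span W'"
        using vec.span_diff[of "a + e" W' a] vec.span_base[of "a + e" W'] vec.span_base[of a W'] aW
        by (auto simp: W'_def)
      then have "W \<subseteq> vec.span W'"
        using vec.span_base[of _ W'] by (auto simp: W'_def)
      moreover have "W' \<subseteq> vec.span W"
        using vec.span_add[of a W e] vec.span_base[of _ W] aW \<open>e \<in> W\<close> by (auto simp: W'_def)
      ultimately show ?thesis
        using spanW vec.span_eq by metis
    qed
    have "line ` W' \<in> ?MB"
      using indep span by (auto simp: minimal_atomic_decomposition_iff_basis W'_def)
    moreover have "line ` W' \<notin> ?h ` ?MA"
    proof
      assume "line ` W' \<in> ?h ` ?MA"
      then have "line e \<in> line ` W'" using e by auto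
      then obtain w where w: "w \<in> W'" "line e = line w" by auto
      show False
      proof (cases "w = a + e")
        case True
        then have "a + e \<in> line e" using w(2) vec.span_base[of w "{w}"] by simp
        then have "a \<in> line e"
          using vec.span_diff[of "a + e" "{e}" e] vec.span_base[of e "{e}"] by simp
        then have "a \<in> vec.span (W - {a})"
          using vec.span_mono[of "{e}" "W - {a}"] aW \<open>e \<in> W\<close> by blast
        with W(3) aW show False by (auto simp: vec.dependent_def)
      next
        case False
        then have "w \<in> W - {e}" using w(1) by (simp add: W'_def)
        then have "e \<in> vec.span (W - {e})"
          using w(2) vec.span_base[of e "{e}"] vec.span_mono[of "{w}" "W - {e}"] by blast
        with e_span show False ..
      qed
    qed
    ultimately show ?thesis by blast
  qed
  then have "?h ` ?MA \<subset> ?MB" using h_in by blast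
  then have "card (?h ` ?MA) < card ?MB" by (intro psubset_card_mono) auto
  then show ?thesis
    unfolding num_min_decomp_def by (simp add: card_image[OF inj])
qed

lemma num_min_decomp_strict_mono_dim:
  fixes A B :: "('a :: {field, finite} ^ 'n) set"
  assumes "vec.subspace A" and "vec.subspace B" and "vec.dim A < vec.dim B"
  shows "num_min_decomp A < num_min_decomp B"
proof -
  obtain A' where A': "vec.subspace A'" "A' \<subseteq> vec.span B" "vec.dim A' = vec.dim A"
    using vec.choose_subspace_of_subspace[of "vec.dim A" B] assms(3) by auto
  have "A' \<subseteq> B"
    using A'(2) vec.span_minimal[OF subset_refl assms(2)] by (rule subset_trans)
  moreover have "A' \<noteq> B" using A'(3) assms(3) by auto
  ultimately have "A' \<subset> B" by blast
  then have "num_min_decomp A' < num_min_decomp B"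
    using A'(1) assms(2) by (intro num_min_decomp_psubset)
  then show ?thesis
    using num_min_decomp_eq_if_dim_eq[OF A'(1) assms(1) A'(3)] by simp
qed

section \<open>Comparison of the two decoders\<close>

theorem proposition2:
  fixes C :: "('a :: {field, finite} ^ 'n) set set"
    and k :: nat
    and M1 M2 :: "('a ^ 'n) set \<Rightarrow> ('a ^ 'n) set"
    and S U :: "('a ^ 'n) set"
  assumes "constant_dimension_code k C"
    and "minimum_distance_decoder subspace_dist C M1"
    and "minimum_distance_decoder decomp_dist C M2"
    and "S \<in> C"
    and "vec.subspace U"
    and "correctly_reconstructs subspace_dist C M1 S U"
  shows "correctly_reconstructs decomp_dist C M2 S U"
proof -
  have code: "vec.subspace T" "vec.dim T = k" if "T \<in> C" for T
    using assms(1) that by (auto simp: constant_dimension_code_def grassmannian_def)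
  have nearest: "nearest_codewords subspace_dist C U = {S}"
    using assms(6) by (simp add: correctly_reconstructs_def)
  have closer: "decomp_dist S U < decomp_dist T U" if T: "T \<in> C" "T \<noteq> S" for T
  proof -
    have "S \<in> nearest_codewords subspace_dist C U" "T \<notin> nearest_codewords subspace_dist C U"
      using nearest T(2) by auto
    then have "subspace_dist S U < subspace_dist T U"
      using T(1) unfolding nearest_codewords_def by fastforce
    then have "vec.dim (T \<inter> U) < vec.dim (S \<inter> U)"
      using code(2)[OF T(1)] code(2)[OF assms(4)] by (simp add: subspace_dist_def)
    then have "num_min_decomp (T \<inter> U) < num_min_decomp (S \<inter> U)"
      using code(1)[OF T(1)] code(1)[OF assms(4)] assms(5)
      by (intro num_min_decomp_strict_mono_dim vec.subspace_inter)
    moreover have "num_min_decomp S = num_min_decomp T"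
      using code T(1) assms(4) by (intro num_min_decomp_eq_if_dim_eq) auto
    ultimately show ?thesis by (simp add: decomp_dist_def)
  qed
  have "nearest_codewords decomp_dist C U = {S}"
  proof (intro equalityI subsetI)
    fix T assume "T \<in> nearest_codewords decomp_dist C U"
    then have "T \<in> C" "decomp_dist T U \<le> decomp_dist S U"
      using assms(4) by (auto simp: nearest_codewords_def)
    then show "T \<in> {S}" using closer[of T] by fastforce
  next
    fix T assume "T \<in> {S}"
    then show "T \<in> nearest_codewords decomp_dist C U"
      using closer assms(4) by (force simp: nearest_codewords_def)
  qed
  then show ?thesis
    using correctly_reconstructs_iff[OF assms(3,5)] by simp
qed

end
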